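(* Let $f,f'\colon X\to Z$ and $g,g'\colon Y\to Z$ be continuous maps such that $f\simeq f'$ and $g\simeq g'$. Then $$\mathrm{TC}_H(f,g)=\mathrm{TC}_H(f',g').$$
   Context: All maps are continuous, $I=[0,1]$, and $Z^I$ is the path space with the compact-open topology; $\pi_Z\colon Z^I\to Z\times Z$ is $\pi_Z(\gamma)=(\gamma(0),\gamma(1))$. For maps $f\colon X\to Z$, $g\colon Y\to Z$, a subset $A\subseteq X\times Y$ is $(f,g)$-sectional if there is a continuous map $\sigma\colon A\to Z^I$ with $\sigma(x,y)(0)=f(x)$ and $\sigma(x,y)(1)=g(y)$ for all $(x,y)\in A$, i.e. $\pi_Z\circ\sigma=(f\times g)|_A$. The homotopy bivariate topological complexity $\mathrm{TC}_H(f,g)$ is the least integer $k\ge 0$ such that $X\times Y$ can be covered by $k+1$ open $(f,g)$-sectional subsets, and $\infty$ if no such $k$ exists. *)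

theory Defs
  imports "HOL-Analysis.Analysis"
begin

(* A point of the mapping space is a continuous map normalised to be undefined outside
   topspace X: continuous_map ignores the values there, so without the extensionality
   condition one map would be represented by many functions. *)
definition cmaps :: "'a topology \<Rightarrow> 'b topology \<Rightarrow> ('a \<Rightarrow> 'b) set" where
  "cmaps X Z = {h \<in> extensional (topspace X). continuous_map X Z h}"

definition compact_open_topology :: "'a topology \<Rightarrow> 'b topology \<Rightarrow> ('a \<Rightarrow> 'b) topology" where
  "compact_open_topology X Z =
     topology_generated_by
       {{h \<in> cmaps X Z. h ` K \<subseteq> U} | K U. compactin X K \<and> openin Z U}"

lemma topspace_compact_open_topology [simp]:
  "topspace (compact_open_topology X Z) = cmaps X Z"
proof -
  have "{h \<in> cmaps X Z. h ` {} \<subseteq> {}} \<in>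
      {{h \<in> cmaps X Z. h ` K \<subseteq> U} | K U. compactin X K \<and> openin Z U}"
    using compactin_empty openin_empty by blast
  then have "cmaps X Z \<subseteq> \<Union>{{h \<in> cmaps X Z. h ` K \<subseteq> U} | K U. compactin X K \<and> openin Z U}"
    by auto
  then show ?thesis
    unfolding compact_open_topology_def topology_generated_by_topspace by blast
qed

definition path_space :: "'c topology \<Rightarrow> (real \<Rightarrow> 'c) topology" where
  "path_space Z = compact_open_topology (top_of_set {0..1}) Z"

lemma topspace_path_space:
  "topspace (path_space Z) = {\<gamma> \<in> extensional {0..1}. pathin Z \<gamma>}"
  by (simp add: path_space_def cmaps_def pathin_def)

definition path_ends :: "(real \<Rightarrow> 'c) \<Rightarrow> 'c \<times> 'c" where
  "path_ends \<gamma> = (\<gamma> 0, \<gamma> 1)"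

definition sectional ::
  "'a topology \<Rightarrow> 'b topology \<Rightarrow> 'c topology \<Rightarrow> ('a \<Rightarrow> 'c) \<Rightarrow> ('b \<Rightarrow> 'c) \<Rightarrow> ('a \<times> 'b) set \<Rightarrow> bool"
where
  "sectional X Y Z f g A \<longleftrightarrow>
     A \<subseteq> topspace X \<times> topspace Y \<and>
     (\<exists>\<sigma>. continuous_map (subtopology (prod_topology X Y) A) (path_space Z) \<sigma> \<and>
          (\<forall>(x, y) \<in> A. path_ends (\<sigma> (x, y)) = (f x, g y)))"

(* The infimum of the empty set of extended naturals is \<infinity>. *)
definition TC_H ::
  "'a topology \<Rightarrow> 'b topology \<Rightarrow> 'c topology \<Rightarrow> ('a \<Rightarrow> 'c) \<Rightarrow> ('b \<Rightarrow> 'c) \<Rightarrow> enat"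
where
  "TC_H X Y Z f g =
     Inf {enat k | k. \<exists>U :: nat \<Rightarrow> ('a \<times> 'b) set.
            (\<forall>i\<le>k. openin (prod_topology X Y) (U i) \<and> sectional X Y Z f g (U i)) \<and>
            topspace X \<times> topspace Y = (\<Union>i\<le>k. U i)}"

end

theory Submission
  imports Defs
begin

text \<open>
  A section over \<open>A\<close> is a continuous family of paths from \<open>f x\<close> to \<open>g y\<close> with parameter
  \<open>(x, y) \<in> A\<close>. Since the unit interval is locally compact and Hausdorff, the exponential law
  for the compact-open topology (\<open>continuous_map_compact_open_curry\<close> and
  \<open>continuous_map_compact_open_uncurry\<close>) says that such a family is the same thing as a homotopy
  on \<open>A\<close> from \<open>f \<circ> fst\<close> to \<open>g \<circ> snd\<close>. Hence \<open>A\<close> is sectional for \<open>(f, g)\<close> precisely when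
  these two maps are homotopic on \<open>A\<close> (\<open>sectional_iff_homotopic\<close>). This condition depends only on
  the homotopy classes of \<open>f\<close> and \<open>g\<close>, because homotopy is an equivalence relation compatible
  with composition. So both pairs have the same sectional sets, and therefore the same
  topological complexity.
\<close>

text \<open>
  The easy half of the exponential law; no hypothesis on \<open>X\<close> is needed. The parameters \<open>w\<close> for
  which the compact set \<open>K\<close> is not mapped into \<open>U\<close> form the projection of a closed subset of
  \<open>K \<times> W\<close>, and projecting along a compact factor is a closed map.
\<close>

lemma continuous_map_compact_open_curry:
  assumes H: "continuous_map (prod_topology X W) Z H"
  shows "continuous_map W (compact_open_topology X Z)
           (\<lambda>w. restrict (\<lambda>x. H (x, w)) (topspace X))"
    (is "continuous_map W _ ?c")
proof -
  have c_in: "?c w \<in> cmaps X Z" if "w \<in> topspace W" for w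
  proof -
    have "continuous_map X (prod_topology X W) (\<lambda>x. (x, w))"
      using that by (simp add: continuous_map_pairwise o_def)
    then have "continuous_map X Z (H \<circ> (\<lambda>x. (x, w)))"
      using H continuous_map_compose by blast
    then have "continuous_map X Z (?c w)"
      by (rule continuous_map_eq) simp
    then show ?thesis
      by (simp add: cmaps_def)
  qed
  have openin_preimage: "openin W {w \<in> topspace W. ?c w ` K \<subseteq> U}"
    if K: "compactin X K" and U: "openin Z U" for K U
  proof -
    let ?KW = "prod_topology (subtopology X K) W"
    have KX: "K \<subseteq> topspace X"
      using K compactin_subset_topspace by blast
    have "continuous_map ?KW Z H"
      using H by (simp add: prod_topology_subtopology continuous_map_from_subtopology)
    moreover have "closedin Z (topspace Z - U)"
      using U by blast
    ultimately have "closedin ?KW {p \<in> topspace ?KW. H p \<in> topspace Z - U}"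
      using closedin_continuous_map_preimage by blast
    moreover have "closed_map ?KW W snd"
      using K by (simp add: closed_map_snd compact_space_subtopology)
    ultimately have "closedin W (snd ` {p \<in> topspace ?KW. H p \<in> topspace Z - U})"
      unfolding closed_map_def by blast
    moreover have "{w \<in> topspace W. ?c w ` K \<subseteq> U}
        = topspace W - snd ` {p \<in> topspace ?KW. H p \<in> topspace Z - U}"
    proof -
      have "H (x, w) \<in> topspace Z" if "x \<in> K" "w \<in> topspace W" for x w
        using continuous_map_image_subset_topspace[OF H] that KX by auto
      then show ?thesis
        using KX by (auto simp: image_iff)
    qed
    ultimately show ?thesis
      by auto
  qed
  show ?thesis
    unfolding compact_open_topology_def
  proof (rule continuous_on_generated_topo)
    fix S assume "S \<in> {{h \<in> cmaps X Z. h ` K \<subseteq> U} | K U. compactin X K \<and> openin Z U}"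
    then obtain K U where S: "S = {h \<in> cmaps X Z. h ` K \<subseteq> U}"
      and KU: "compactin X K" "openin Z U"
      by blast
    have "?c -` S \<inter> topspace W = {w \<in> topspace W. ?c w ` K \<subseteq> U}"
      using c_in S by auto
    then show "openin W (?c -` S \<inter> topspace W)"
      using openin_preimage[OF KU] by simp
  next
    have "cmaps X Z = \<Union>{{h \<in> cmaps X Z. h ` K \<subseteq> U} | K U. compactin X K \<and> openin Z U}"
      using topspace_compact_open_topology[of X Z]
      unfolding compact_open_topology_def topology_generated_by_topspace by simp
    then show "?c ` topspace W
        \<subseteq> \<Union>{{h \<in> cmaps X Z. h ` K \<subseteq> U} | K U. compactin X K \<and> openin Z U}"
      using c_in by blast
  qed
qed

text \<open>
  The other half of the exponential law. Here \<open>X\<close> must be locally compact, in the strong sense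
  that every point has arbitrarily small compact neighbourhoods: near \<open>x\<close> a single compact
  neighbourhood \<open>K\<close> is mapped into \<open>U\<close> by \<open>s w\<close>, and the subbasic open set of maps
  sending \<open>K\<close> into \<open>U\<close> then controls all parameters close to \<open>w\<close>.
\<close>

lemma continuous_map_compact_open_uncurry:
  assumes X: "neighbourhood_base_of (compactin X) X"
    and s: "continuous_map W (compact_open_topology X Z) s"
  shows "continuous_map (prod_topology X W) Z (\<lambda>(x, w). s w x)"
proof -
  have s_cont: "continuous_map X Z (s w)" and s_in: "s w \<in> cmaps X Z"
    if "w \<in> topspace W" for w
  proof -
    show "s w \<in> cmaps X Z"
      using continuous_map_image_subset_topspace[OF s] that by auto
    then show "continuous_map X Z (s w)"
      by (simp add: cmaps_def)
  qed
  have "\<exists>T. openin (prod_topology X W) T \<and> (x, w) \<in> T \<and> (\<forall>(x', w') \<in> T. s w' x' \<in> U)"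
    if x: "x \<in> topspace X" and w: "w \<in> topspace W" and U: "openin Z U" and sU: "s w x \<in> U"
    for x w U
  proof -
    have "openin X {x' \<in> topspace X. s w x' \<in> U}"
      using s_cont[OF w] U openin_continuous_map_preimage by blast
    then obtain V K where V: "openin X V" "x \<in> V" "V \<subseteq> K"
      and K: "compactin X K" "K \<subseteq> {x' \<in> topspace X. s w x' \<in> U}"
      using X[unfolded neighbourhood_base_of, rule_format,
          of "{x' \<in> topspace X. s w x' \<in> U}" x] x sU by auto
    let ?N = "{w' \<in> topspace W. s w' \<in> {h \<in> cmaps X Z. h ` K \<subseteq> U}}"
    have "openin (compact_open_topology X Z) {h \<in> cmaps X Z. h ` K \<subseteq> U}"
      unfolding compact_open_topology_def
      by (rule topology_generated_by_Basis) (use K U in blast)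
    then have "openin W ?N"
      using s openin_continuous_map_preimage by blast
    then have "openin (prod_topology X W) (V \<times> ?N)"
      using V by (simp add: openin_prod_Times_iff)
    moreover have "(x, w) \<in> V \<times> ?N"
      using V K w s_in[OF w] by auto
    moreover have "\<forall>(x', w') \<in> V \<times> ?N. s w' x' \<in> U"
      using V by auto
    ultimately show ?thesis
      by blast
  qed
  moreover have "s w x \<in> topspace Z" if "x \<in> topspace X" "w \<in> topspace W" for x w
    using continuous_map_image_subset_topspace[OF s_cont] that by blast
  ultimately have "topcontinuous_at (prod_topology X W) Z (\<lambda>(x, w). s w x) (x, w)"
    if "x \<in> topspace X" "w \<in> topspace W" for x w
    using that unfolding topcontinuous_at_def by (auto simp: split_beta)
  then show ?thesis
    by (auto simp: continuous_map_eq_topcontinuous_at)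
qed

lemma neighbourhood_base_of_compactin_unit_interval:
  "neighbourhood_base_of (compactin (top_of_set {0..1::real})) (top_of_set {0..1})"
proof -
  have "locally_compact_space (top_of_set {0..1::real})"
    by (intro compact_imp_locally_compact_space) (simp add: compact_space_subtopology)
  moreover have "Hausdorff_space (top_of_set {0..1::real})"
    by (simp add: Hausdorff_space_subtopology)
  ultimately show ?thesis
    using locally_compact_space_neighbourhood_base by blast
qed

lemma sectional_iff_homotopic:
  assumes A: "A \<subseteq> topspace X \<times> topspace Y"
  shows "sectional X Y Z f g A \<longleftrightarrow>
    homotopic_with (\<lambda>_. True) (subtopology (prod_topology X Y) A) Z (f \<circ> fst) (g \<circ> snd)"
    (is "_ \<longleftrightarrow> homotopic_with _ ?A Z _ _")
proof -
  let ?I = "top_of_set {0..1::real}"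
  have top_A: "topspace ?A = A"
    using A by auto
  have homotopic_iff: "homotopic_with (\<lambda>_. True) ?A Z (f \<circ> fst) (g \<circ> snd) \<longleftrightarrow>
      (\<exists>h. continuous_map (prod_topology ?I ?A) Z h \<and>
           (\<forall>p\<in>A. h (0, p) = f (fst p)) \<and> (\<forall>p\<in>A. h (1, p) = g (snd p)))"
    by (subst homotopic_with) (simp_all add: top_A del: topspace_subtopology)
  show ?thesis
  proof
    assume "sectional X Y Z f g A"
    then obtain s where s: "continuous_map ?A (compact_open_topology ?I Z) s"
      and ends: "\<forall>(x, y) \<in> A. path_ends (s (x, y)) = (f x, g y)"
      unfolding sectional_def path_space_def by blast
    have "continuous_map (prod_topology ?I ?A) Z (\<lambda>(t, p). s p t)"
      by (rule continuous_map_compact_open_uncurry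
            [OF neighbourhood_base_of_compactin_unit_interval s])
    then show "homotopic_with (\<lambda>_. True) ?A Z (f \<circ> fst) (g \<circ> snd)"
      unfolding homotopic_iff using ends
      by (intro exI[of _ "\<lambda>(t, p). s p t"]) (auto simp: path_ends_def)
  next
    assume "homotopic_with (\<lambda>_. True) ?A Z (f \<circ> fst) (g \<circ> snd)"
    then obtain h where h: "continuous_map (prod_topology ?I ?A) Z h"
      and ends: "\<forall>p\<in>A. h (0, p) = f (fst p)" "\<forall>p\<in>A. h (1, p) = g (snd p)"
      unfolding homotopic_iff by blast
    have "continuous_map ?A (path_space Z) (\<lambda>p. restrict (\<lambda>t. h (t, p)) {0..1})"
      using continuous_map_compact_open_curry[OF h] by (simp add: path_space_def)
    then show "sectional X Y Z f g A"
      unfolding sectional_def using A ends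
      by (intro conjI exI[of _ "\<lambda>p. restrict (\<lambda>t. h (t, p)) {0..1}"])
        (auto simp: path_ends_def)
  qed
qed

lemma sectional_homotopic:
  assumes f: "homotopic_with (\<lambda>_. True) X Z f f'" and g: "homotopic_with (\<lambda>_. True) Y Z g g'"
    and sec: "sectional X Y Z f g A"
  shows "sectional X Y Z f' g' A"
proof -
  let ?A = "subtopology (prod_topology X Y) A"
  have A: "A \<subseteq> topspace X \<times> topspace Y"
    using sec by (simp add: sectional_def)
  have "continuous_map ?A X fst" "continuous_map ?A Y snd"
    by (simp_all add: continuous_map_fst continuous_map_snd continuous_map_from_subtopology)
  then have "homotopic_with (\<lambda>_. True) ?A Z (f \<circ> fst) (f' \<circ> fst)"
    and "homotopic_with (\<lambda>_. True) ?A Z (g \<circ> snd) (g' \<circ> snd)"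
    by (simp_all add: homotopic_with_compose_continuous_map_right[OF f]
        homotopic_with_compose_continuous_map_right[OF g])
  moreover have "homotopic_with (\<lambda>_. True) ?A Z (f \<circ> fst) (g \<circ> snd)"
    using sec sectional_iff_homotopic[OF A] by blast
  ultimately have "homotopic_with (\<lambda>_. True) ?A Z (f' \<circ> fst) (g' \<circ> snd)"
    by (meson homotopic_with_symD homotopic_with_trans)
  then show ?thesis
    using sectional_iff_homotopic[OF A] by blast
qed

theorem corollary5p7:
  fixes X :: "'a topology" and Y :: "'b topology" and Z :: "'c topology"
    and f f' :: "'a \<Rightarrow> 'c" and g g' :: "'b \<Rightarrow> 'c"
  assumes "continuous_map X Z f" and "continuous_map X Z f'"
    and "continuous_map Y Z g" and "continuous_map Y Z g'"
    and "homotopic_with (\<lambda>_. True) X Z f f'"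
    and "homotopic_with (\<lambda>_. True) Y Z g g'"
  shows "TC_H X Y Z f g = TC_H X Y Z f' g'"
proof -
  have "sectional X Y Z f g A \<longleftrightarrow> sectional X Y Z f' g' A" for A
    using sectional_homotopic[OF assms(5,6)]
      sectional_homotopic[OF homotopic_with_symD[OF assms(5)] homotopic_with_symD[OF assms(6)]]
    by blast
  then show ?thesis
    by (simp add: TC_H_def)
qed

end
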